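(* Let $\widetilde B$ be an $m\times n$ extended exchange matrix ($m\ge n$) such that the underlying exchange matrix $B$ is of finite type. Then $\mathcal P^{\widetilde B}_{\tilde\lambda}=\{\tilde\lambda\}$ for every $\tilde\lambda\in\mathbb R^m$.
   Context: **Mutation.** An exchange matrix is an integer $n\times n$ matrix $B=(b_{ij})$ for which there are positive $d_1,\dots,d_n$ with $d_ib_{ij}=-d_jb_{ji}$. An $m\times n$ extended exchange matrix ($m\ge n$) is an integer matrix $\widetilde B=(b_{ij})$ whose top $n\times n$ part $B$ is an exchange matrix. Write $[a]_+=\max(a,0)$. For $k\in\{1,\dots,n\}$, $\mu_k(\widetilde B)=(b'_{ij})$ has $b'_{ij}=-b_{ij}$ if $k\in\{i,j\}$ and $b'_{ij}=b_{ij}+\operatorname{sgn}(b_{ik})[b_{ik}b_{kj}]_+$ otherwise. Sequences $\boldsymbol k=k_r\cdots k_1$ of indices in $\{1,\dots,n\}$ are applied from right to left: $\mu_{\boldsymbol k}=\mu_{k_r}\circ\cdots\circ\mu_{k_1}$. **Mutation maps.** For $x\in\mathbb R^m$, the mutation map at $k$ (denoted $\eta_k^{\mathbb B^T}$, where $\mathbb B$ is a skew-symmetrizable $m\times m$ matrix extending $\widetilde B$; only its first $n$ columns matter) replaces $x_k$ by $-x_k$ and $x_i$ ($i\neq k$) by $x_i+\operatorname{sgn}(b_{ik})[b_{ik}x_k]_+$. For $\boldsymbol k=k_r\cdots k_1$, $\eta_{\boldsymbol k}^{\mathbb B^T}$ is the composition of these maps for $\widetilde B$ at $k_1$, then $\mu_{k_1}(\widetilde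 B)$ at $k_2$, etc. **Dominance region.** $\mathcal P^{\widetilde B}_{\tilde\lambda,\boldsymbol k}=(\eta_{\boldsymbol k}^{\mathbb B^T})^{-1}\{\eta_{\boldsymbol k}^{\mathbb B^T}(\tilde\lambda)+\mu_{\boldsymbol k}(\widetilde B)\alpha:\alpha\in\mathbb R^n,\alpha\ge0\}$ (componentwise inequality) and $\mathcal P^{\widetilde B}_{\tilde\lambda}=\bigcap_{\boldsymbol k}\mathcal P^{\widetilde B}_{\tilde\lambda,\boldsymbol k}$ over all finite sequences $\boldsymbol k$ of indices in $\{1,\dots,n\}$. **Finite type.** $B$ is of finite type if its cluster algebra has finitely many seeds; equivalently, $B$ is mutation-equivalent to an exchange matrix $B'$ whose underlying Cartan matrix ($a_{ii}=2$, $a_{ij}=-|b'_{ij}|$ for $i\ne j$) is of finite type (possibly decomposable). *)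

theory Defs
  imports Jordan_Normal_Form.Matrix
begin

text \<open>
  All indices are 0-based: the index set \<open>{1,\<dots>,n}\<close> is rendered as \<open>{..<n}\<close>.
\<close>

definition exchange_matrix :: "nat \<Rightarrow> int mat \<Rightarrow> bool" where
  "exchange_matrix n B \<longleftrightarrow>
     B \<in> carrier_mat n n \<and>
     (\<exists>d :: nat \<Rightarrow> real. (\<forall>i<n. 0 < d i) \<and>
        (\<forall>i<n. \<forall>j<n. d i * real_of_int (B $$ (i, j)) = - (d j * real_of_int (B $$ (j, i)))))"

definition top_part :: "int mat \<Rightarrow> int mat" where
  "top_part Bt = mat (dim_col Bt) (dim_col Bt) (\<lambda>(i, j). Bt $$ (i, j))"

definition extended_exchange_matrix :: "nat \<Rightarrow> nat \<Rightarrow> int mat \<Rightarrow> bool" where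
  "extended_exchange_matrix m n Bt \<longleftrightarrow>
     n \<le> m \<and> Bt \<in> carrier_mat m n \<and> exchange_matrix n (top_part Bt)"

definition mutate :: "nat \<Rightarrow> int mat \<Rightarrow> int mat" where
  "mutate k B = mat (dim_row B) (dim_col B) (\<lambda>(i, j).
     if i = k \<or> j = k then - (B $$ (i, j))
     else B $$ (i, j) + sgn (B $$ (i, k)) * max (B $$ (i, k) * B $$ (k, j)) 0)"

text \<open>
  A sequence \<open>k\<^sub>r \<cdots> k\<^sub>1\<close> is the list \<open>[k\<^sub>r, \<dots>, k\<^sub>1]\<close>; its last entry acts first.
\<close>

definition mutate_seq :: "nat list \<Rightarrow> int mat \<Rightarrow> int mat" where
  "mutate_seq ks B = foldr mutate ks B"

text \<open>
  The mutation map at \<open>k\<close> uses only column \<open>k\<close> of the skew-symmetrizable \<open>m \<times> m\<close> matrix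
  extending \<open>Bt\<close>. For \<open>k < n\<close> this is a column of \<open>Bt\<close> itself, and mutating the larger matrix
  in directions below \<open>n\<close> mutates its first \<open>n\<close> columns in the same way as \<open>Bt\<close>, so no
  extension has to be chosen.
\<close>

definition mutation_map :: "int mat \<Rightarrow> nat \<Rightarrow> real vec \<Rightarrow> real vec" where
  "mutation_map Bt k x = vec (dim_row Bt) (\<lambda>i.
     if i = k then - (x $ k)
     else x $ i + real_of_int (sgn (Bt $$ (i, k))) * max (real_of_int (Bt $$ (i, k)) * x $ k) 0)"

fun mutation_map_seq :: "int mat \<Rightarrow> nat list \<Rightarrow> real vec \<Rightarrow> real vec" where
  "mutation_map_seq Bt [] x = x"
| "mutation_map_seq Bt (k # ks) x =
     mutation_map (mutate_seq ks Bt) k (mutation_map_seq Bt ks x)"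

definition dominance_region_at :: "int mat \<Rightarrow> real vec \<Rightarrow> nat list \<Rightarrow> real vec set" where
  "dominance_region_at Bt lam ks =
     {x \<in> carrier_vec (dim_row Bt).
        mutation_map_seq Bt ks x \<in>
          {mutation_map_seq Bt ks lam + map_mat real_of_int (mutate_seq ks Bt) *\<^sub>v \<alpha> | \<alpha>.
             \<alpha> \<in> carrier_vec (dim_col Bt) \<and> (\<forall>j < dim_col Bt. 0 \<le> \<alpha> $ j)}}"

definition dominance_region :: "int mat \<Rightarrow> real vec \<Rightarrow> real vec set" where
  "dominance_region Bt lam = (\<Inter>ks \<in> lists {..<dim_col Bt}. dominance_region_at Bt lam ks)"

definition cartan_companion :: "int mat \<Rightarrow> int mat" where
  "cartan_companion B = mat (dim_row B) (dim_col B) (\<lambda>(i, j).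
     if i = j then 2 else - \<bar>B $$ (i, j)\<bar>)"

text \<open>
  A Cartan matrix of finite type: a symmetrizable generalized Cartan matrix whose
  symmetrization \<open>(d\<^sub>i a\<^sub>i\<^sub>j)\<close> is positive definite. The vanishing condition
  \<open>a\<^sub>i\<^sub>j = 0 \<longleftrightarrow> a\<^sub>j\<^sub>i = 0\<close> follows from symmetrizability, and indecomposability is not required.
\<close>

definition finite_type_cartan :: "nat \<Rightarrow> int mat \<Rightarrow> bool" where
  "finite_type_cartan n A \<longleftrightarrow>
     A \<in> carrier_mat n n \<and>
     (\<forall>i<n. A $$ (i, i) = 2) \<and>
     (\<forall>i<n. \<forall>j<n. i \<noteq> j \<longrightarrow> A $$ (i, j) \<le> 0) \<and>
     (\<exists>d :: nat \<Rightarrow> real. (\<forall>i<n. 0 < d i) \<and>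
        (\<forall>i<n. \<forall>j<n. d i * real_of_int (A $$ (i, j)) = d j * real_of_int (A $$ (j, i))) \<and>
        (\<forall>x \<in> carrier_vec n. x \<noteq> 0\<^sub>v n \<longrightarrow>
           0 < (\<Sum>i<n. \<Sum>j<n. d i * real_of_int (A $$ (i, j)) * x $ i * x $ j)))"

definition mutation_equivalent :: "nat \<Rightarrow> int mat \<Rightarrow> int mat \<Rightarrow> bool" where
  "mutation_equivalent n B B' \<longleftrightarrow> (\<exists>ks \<in> lists {..<n}. B' = mutate_seq ks B)"

text \<open>
  Finite type in terms of exchange matrices, which by the Fomin--Zelevinsky classification is
  the same as the cluster algebra of \<open>B\<close> having finitely many seeds.
\<close>

definition finite_type :: "nat \<Rightarrow> int mat \<Rightarrow> bool" where
  "finite_type n B \<longleftrightarrow>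
     (\<exists>B'. exchange_matrix n B' \<and> mutation_equivalent n B B' \<and>
           finite_type_cartan n (cartan_companion B'))"

end

theory Submission
  imports Defs Jordan_Normal_Form.Determinant
begin

text \<open>
  Dominance regions are compatible with mutation and mutation maps are injective, so the initial
  seed may be replaced. A positive definite Cartan matrix has a forest as its Dynkin diagram,
  which therefore can be mutated at sources until the orientation is bipartite. Along the
  bipartite belt starting there, the difference of \<open>lam\<close> and a dominated \<open>x\<close>, read off at the
  colour about to be mutated, is nonnegative and satisfies \<open>w (s + 2) + w s \<le> N w (s + 1)\<close>, where
  \<open>2 - N\<close> is the Cartan matrix. As \<open>2 - N\<close> is a nonsingular M-matrix, a positive functional turns
  \<open>w\<close> into a nonnegative strictly concave sequence on the natural numbers, so \<open>w = 0\<close>. Hence \<open>x\<close>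
  and \<open>lam\<close> have the same first \<open>n\<close> coordinates, and the others are compared by mutating at
  isolated vertices.
\<close>

subsection \<open>Mutation along sequences\<close>

lemma dim_mutate [simp]:
  "dim_row (mutate k B) = dim_row B" "dim_col (mutate k B) = dim_col B"
  by (simp_all add: mutate_def)

lemma index_mutate:
  "i < dim_row B \<Longrightarrow> j < dim_col B \<Longrightarrow> mutate k B $$ (i, j) =
     (if i = k \<or> j = k then - (B $$ (i, j))
      else B $$ (i, j) + sgn (B $$ (i, k)) * max (B $$ (i, k) * B $$ (k, j)) 0)"
  by (simp add: mutate_def)

lemma mutate_seq_simps [simp]:
  "mutate_seq [] B = B" "mutate_seq (k # ks) B = mutate k (mutate_seq ks B)"
  by (simp_all add: mutate_seq_def)

lemma mutate_seq_append: "mutate_seq (ks @ ls) B = mutate_seq ks (mutate_seq ls B)"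
  by (simp add: mutate_seq_def)

lemma dim_mutate_seq [simp]:
  "dim_row (mutate_seq ks B) = dim_row B" "dim_col (mutate_seq ks B) = dim_col B"
  by (induction ks) auto

text \<open>For \<open>i\<close>, \<open>j\<close>, \<open>k\<close> below the number of columns,
  the mutated entry involves only rows \<open>i\<close> and \<open>k\<close>, which lie in the top
  part. Finite type of the top part can thus select mutations of the whole matrix.\<close>

lemma top_part_mutate_seq:
  assumes "dim_col B \<le> dim_row B" "set ks \<subseteq> {..<dim_col B}"
  shows "top_part (mutate_seq ks B) = mutate_seq ks (top_part B)"
  using assms(2)
proof (induction ks)
  case (Cons k ks)
  have "top_part (mutate k (mutate_seq ks B)) = mutate k (top_part (mutate_seq ks B))"
    using assms(1) Cons.prems by (intro eq_matI) (auto simp: top_part_def index_mutate)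
  with Cons show ?case by simp
qed simp

lemma dim_mutation_map [simp]: "dim_vec (mutation_map B k x) = dim_row B"
  by (simp add: mutation_map_def)

lemma index_mutation_map:
  "i < dim_row B \<Longrightarrow> mutation_map B k x $ i =
     (if i = k then - (x $ k)
      else x $ i + real_of_int (sgn (B $$ (i, k))) * max (real_of_int (B $$ (i, k)) * x $ k) 0)"
  by (simp add: mutation_map_def)

lemma mutation_map_seq_append:
  "mutation_map_seq B (ks @ ls) x =
     mutation_map_seq (mutate_seq ls B) ks (mutation_map_seq B ls x)"
  by (induction ks) (simp_all add: mutate_seq_append)

lemma mutation_map_seq_carrier:
  "x \<in> carrier_vec (dim_row B) \<Longrightarrow> mutation_map_seq B ks x \<in> carrier_vec (dim_row B)"
  by (cases ks) (simp, simp only: mutation_map_seq.simps carrier_dim_vec dim_mutation_map dim_mutate_seq)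

text \<open>Coordinate \<open>k\<close> is merely negated, and the correction to every other
  coordinate depends on coordinate \<open>k\<close> alone.\<close>

lemma mutation_map_inj:
  assumes "x \<in> carrier_vec (dim_row B)" "y \<in> carrier_vec (dim_row B)" "k < dim_row B"
    and eq: "mutation_map B k x = mutation_map B k y"
  shows "x = y"
proof (rule eq_vecI)
  have *: "mutation_map B k x $ i = mutation_map B k y $ i" for i
    using eq by simp
  have k: "x $ k = y $ k"
    using *[of k] assms(3) by (simp add: index_mutation_map)
  show "x $ i = y $ i" if "i < dim_vec y" for i
    using *[of i] that k assms(2) by (auto simp: index_mutation_map split: if_splits)
qed (use assms in auto)

lemma mutation_map_seq_inj:
  assumes "x \<in> carrier_vec (dim_row B)" "y \<in> carrier_vec (dim_row B)" "set ks \<subseteq> {..<dim_row B}"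
    and "mutation_map_seq B ks x = mutation_map_seq B ks y"
  shows "x = y"
  using assms(3,4)
proof (induction ks)
  case (Cons k ks)
  have "mutation_map_seq B ks x = mutation_map_seq B ks y"
    by (rule mutation_map_inj[where B = "mutate_seq ks B" and k = k])
       (use Cons.prems assms(1,2) in \<open>auto intro: mutation_map_seq_carrier\<close>)
  with Cons show ?case by simp
qed simp

text \<open>The correction made by a mutation at \<open>k < n\<close> depends only on coordinate
  \<open>k\<close>, where the two vectors agree throughout, so it cancels in the difference.\<close>

lemma mutation_map_seq_diff:
  assumes "set ks \<subseteq> {..<n}" "n \<le> dim_row B" "\<forall>k<n. x $ k = y $ k" "i < dim_row B"
  shows "mutation_map_seq B ks x $ i - mutation_map_seq B ks y $ i = x $ i - y $ i"
  using assms(1,4)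
proof (induction ks arbitrary: i)
  case (Cons k ks)
  have "mutation_map_seq B ks x $ k = mutation_map_seq B ks y $ k"
    using Cons.IH[of k] Cons.prems assms(2,3) by auto
  moreover have "x $ k = y $ k" using Cons.prems assms(3) by auto
  ultimately show ?case
    using Cons by (auto simp: index_mutation_map)
qed simp

section \<open>Dominance regions under a change of seed\<close>

lemma dominance_region_mutate:
  assumes x: "x \<in> dominance_region B lam" and ks: "set ks \<subseteq> {..<dim_col B}"
  shows "mutation_map_seq B ks x \<in>
           dominance_region (mutate_seq ks B) (mutation_map_seq B ks lam)"
proof -
  have "mutation_map_seq B ks x \<in>
          dominance_region_at (mutate_seq ks B) (mutation_map_seq B ks lam) ls"
    if "set ls \<subseteq> {..<dim_col B}" for ls
  proof -
    \<comment> \<open>The last entry acts first, so \<open>ls @ ks\<close> moves to the new seed and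
      then applies \<open>ls\<close>: the conditions at the new seed are among those at the old
      one.\<close>
    have "ls @ ks \<in> lists {..<dim_col B}" using that ks by auto
    then have "x \<in> dominance_region_at B lam (ls @ ks)"
      using x unfolding dominance_region_def by blast
    then show ?thesis
      by (auto simp: dominance_region_at_def mutation_map_seq_append mutate_seq_append
          intro: mutation_map_seq_carrier)
  qed
  then show ?thesis by (auto simp: dominance_region_def in_lists_conv_set subset_eq)
qed

lemma dominance_region_carrier:
  "x \<in> dominance_region B lam \<Longrightarrow> x \<in> carrier_vec (dim_row B)"
  by (auto simp: dominance_region_def dominance_region_at_def dest: bspec[where x = "[]"])

text \<open>Only the condition for the empty sequence is extracted; other seeds are reached through
  \<open>dominance_region_mutate\<close>.\<close>

lemma dominance_regionE:
  assumes "x \<in> dominance_region B lam" "lam \<in> carrier_vec (dim_row B)"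
  obtains \<alpha> where "\<And>j. j < dim_col B \<Longrightarrow> 0 \<le> \<alpha> j"
    and "\<And>i. i < dim_row B \<Longrightarrow>
           x $ i = lam $ i + (\<Sum>j<dim_col B. real_of_int (B $$ (i, j)) * \<alpha> j)"
proof -
  have "x \<in> dominance_region_at B lam []"
    using assms by (auto simp: dominance_region_def dest: bspec[where x = "[]"])
  then obtain a where a: "x = lam + map_mat real_of_int B *\<^sub>v a"
    "a \<in> carrier_vec (dim_col B)" "\<forall>j<dim_col B. 0 \<le> a $ j"
    by (auto simp: dominance_region_at_def)
  have "x $ i = lam $ i + (\<Sum>j<dim_col B. real_of_int (B $$ (i, j)) * a $ j)"
    if "i < dim_row B" for i
    using a that assms(2) by (auto simp: scalar_prod_def atLeast0LessThan)
  with a(3) show ?thesis by (intro that[of "\<lambda>j. a $ j"]) auto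
qed

lemma mem_dominance_region_self:
  assumes "lam \<in> carrier_vec (dim_row B)"
  shows "lam \<in> dominance_region B lam"
proof -
  have "\<exists>\<alpha>. mutation_map_seq B ks lam =
      mutation_map_seq B ks lam + map_mat real_of_int (mutate_seq ks B) *\<^sub>v \<alpha> \<and>
      \<alpha> \<in> carrier_vec (dim_col B) \<and> (\<forall>j<dim_col B. 0 \<le> \<alpha> $ j)" for ks
    using mutation_map_seq_carrier[OF assms, of ks]
    by (intro exI[of _ "0\<^sub>v (dim_col B)"]) (auto intro!: eq_vecI simp: scalar_prod_def)
  then show ?thesis
    using assms by (auto simp: dominance_region_def dominance_region_at_def)
qed

subsection \<open>Mutation at an independent set of sources\<close>

text \<open>At a source \<open>k\<close> the products \<open>B $$ (i, k) * B $$ (k, j)\<close> are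
  nonpositive, so mutation only changes signs in row and column \<open>k\<close>, and nonadjacent
  sources do not disturb each other. Rows from \<open>n\<close> on carry no sign condition, hence
  \<open>i < n\<close> in both conclusions.\<close>

lemma mutate_sources:
  assumes "dim_col B = n" "n \<le> dim_row B" "distinct ks" "set ks \<subseteq> {..<n}"
    and src: "\<forall>k\<in>set ks. \<forall>i<n. 0 \<le> B $$ (i, k) \<and> B $$ (k, i) \<le> 0"
    and indep: "\<forall>k\<in>set ks. \<forall>l\<in>set ks. B $$ (k, l) = 0"
  shows "\<And>i j. i < n \<Longrightarrow> j < n \<Longrightarrow> mutate_seq ks B $$ (i, j) =
           (if i \<in> set ks \<or> j \<in> set ks then - B $$ (i, j) else B $$ (i, j))"
    and "\<And>i. i < n \<Longrightarrow> mutation_map_seq B ks x $ i =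
           (if i \<in> set ks then - x $ i
            else x $ i + (\<Sum>k\<in>set ks. real_of_int (B $$ (i, k)) * max (x $ k) 0))"
proof -
  have "(\<forall>i<n. \<forall>j<n. mutate_seq ks B $$ (i, j) =
           (if i \<in> set ks \<or> j \<in> set ks then - B $$ (i, j) else B $$ (i, j))) \<and>
        (\<forall>i<n. mutation_map_seq B ks x $ i =
           (if i \<in> set ks then - x $ i
            else x $ i + (\<Sum>k\<in>set ks. real_of_int (B $$ (i, k)) * max (x $ k) 0)))"
    using assms(3-6)
  proof (induction ks)
    case (Cons k ks)
    let ?B = "mutate_seq ks B" and ?x = "mutation_map_seq B ks x"
    have IH: "\<forall>i<n. \<forall>j<n. ?B $$ (i, j) =
           (if i \<in> set ks \<or> j \<in> set ks then - B $$ (i, j) else B $$ (i, j))"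
      "\<forall>i<n. ?x $ i =
           (if i \<in> set ks then - x $ i
            else x $ i + (\<Sum>k\<in>set ks. real_of_int (B $$ (i, k)) * max (x $ k) 0))"
      using Cons by auto
    have k: "k < n" "k \<notin> set ks" using Cons.prems by auto
    have col: "?B $$ (i, k) = B $$ (i, k)" if "i < n" for i
      using IH(1) k that Cons.prems(4) by auto
    have row: "?B $$ (k, j) = B $$ (k, j)" if "j < n" for j
      using IH(1) k that Cons.prems(4) by auto
    have src: "0 \<le> B $$ (i, k)" "B $$ (k, i) \<le> 0" if "i < n" for i
      using Cons.prems(3) that by auto
    have "mutate k ?B $$ (i, j) =
           (if i \<in> set (k # ks) \<or> j \<in> set (k # ks) then - B $$ (i, j) else B $$ (i, j))"
      if ij: "i < n" "j < n" for i j
    proof (cases "i = k \<or> j = k")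
      case True
      then show ?thesis
        using ij assms(1,2) k col row by (auto simp: index_mutate)
    next
      case False
      have "B $$ (i, k) * B $$ (k, j) \<le> 0"
        using src ij by (simp add: mult_nonneg_nonpos)
      then show ?thesis
        using False ij assms(1,2) col row IH(1) by (auto simp: index_mutate)
    qed
    moreover have "mutation_map ?B k ?x $ i =
           (if i \<in> set (k # ks) then - x $ i
            else x $ i + (\<Sum>l\<in>set (k # ks). real_of_int (B $$ (i, l)) * max (x $ l) 0))"
      if i: "i < n" for i
    proof -
      \<comment> \<open>Independence makes the correction accumulated at \<open>k\<close> vanish, so
        this coordinate is still the original one.\<close>
      have "(\<Sum>l\<in>set ks. real_of_int (B $$ (k, l)) * max (x $ l) 0) = 0"
        using Cons.prems(4) by (intro sum.neutral) auto
      then have xk: "?x $ k = x $ k"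
        using IH(2) k by auto
      have "real_of_int (sgn b) * max (real_of_int b * y) 0 = real_of_int b * max y 0"
        if "0 \<le> b" for b :: int and y :: real
        using that by (cases "b = 0") (auto simp: max_def zero_le_mult_iff mult_le_0_iff)
      then have "mutation_map ?B k ?x $ i =
          (if i = k then - x $ k else ?x $ i + real_of_int (B $$ (i, k)) * max (x $ k) 0)"
        using i assms(1,2) col src xk by (auto simp: index_mutation_map)
      moreover have "B $$ (i, k) = 0" if "i \<in> set ks"
        using that Cons.prems(4) by auto
      ultimately show ?thesis using IH(2) i k by auto
    qed
    ultimately show ?case by simp
  qed simp
  then show "\<And>i j. i < n \<Longrightarrow> j < n \<Longrightarrow> mutate_seq ks B $$ (i, j) =
           (if i \<in> set ks \<or> j \<in> set ks then - B $$ (i, j) else B $$ (i, j))"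
    and "\<And>i. i < n \<Longrightarrow> mutation_map_seq B ks x $ i =
           (if i \<in> set ks then - x $ i
            else x $ i + (\<Sum>k\<in>set ks. real_of_int (B $$ (i, k)) * max (x $ k) 0))"
    by blast+
qed

text \<open>Row \<open>k\<close> is zero, so the products in the mutation rule vanish for every row
  \<open>i\<close>, including those from \<open>n\<close> on, and only column \<open>k\<close>
  changes sign.\<close>

lemma mutate_isolated:
  assumes "dim_col B = n" "n \<le> dim_row B" "distinct ks" "set ks \<subseteq> {..<n}"
    and iso: "\<forall>k\<in>set ks. \<forall>j<n. B $$ (k, j) = 0"
    and "i < dim_row B" "j < n"
  shows "mutate_seq ks B $$ (i, j) = (if j \<in> set ks then - B $$ (i, j) else B $$ (i, j))"
  using assms(3-7)
proof (induction ks arbitrary: i j)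
  case (Cons k ks)
  have IH: "mutate_seq ks B $$ (i, j) = (if j \<in> set ks then - B $$ (i, j) else B $$ (i, j))"
    if "i < dim_row B" "j < n" for i j
    using Cons that by auto
  have "mutate_seq ks B $$ (k, j) = 0" "B $$ (k, j) = 0"
    using IH[of k j] Cons.prems assms(2) by auto
  then show ?case
    using Cons.prems IH[of i j] assms(1) by (auto simp: index_mutate)
qed simp

subsection \<open>Positive definite Cartan data\<close>

text \<open>\<open>N\<close> is 2 minus the Cartan matrix, that is, the weighted adjacency matrix of
  the Dynkin diagram, and \<open>d\<close> symmetrizes it. Functions stand for vectors, so being
  nonzero means having a nonzero value below \<open>n\<close>.\<close>

locale positive_cartan =
  fixes n :: nat and N :: "nat \<Rightarrow> nat \<Rightarrow> int" and d :: "nat \<Rightarrow> real"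
  assumes d_pos: "i < n \<Longrightarrow> 0 < d i"
    and N_nonneg: "0 \<le> N i j"
    and N_diag: "i < n \<Longrightarrow> N i i = 0"
    and N_symm: "i < n \<Longrightarrow> j < n \<Longrightarrow> d i * N i j = d j * N j i"
    and pos_def: "i < n \<Longrightarrow> x i \<noteq> 0 \<Longrightarrow>
      0 < (\<Sum>i<n. \<Sum>j<n. d i * (if i = j then 2 else - real_of_int (N i j)) * x i * x j)"
begin

lemma N_zero_iff:
  assumes "i < n" "j < n"
  shows "N i j = 0 \<longleftrightarrow> N j i = 0"
proof -
  have "d i \<noteq> 0" "d j \<noteq> 0" using d_pos[of i] d_pos[of j] assms by auto
  then show ?thesis using N_symm[OF assms] by auto
qed

text \<open>If all degrees within \<open>S\<close> were at least 2, a test vector supported on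
  \<open>S\<close> would make every row sum of the quadratic form at most 2 minus the degree,
  contradicting positive definiteness.\<close>

lemma exists_leaf:
  assumes "S \<subseteq> {..<n}" "S \<noteq> {}"
  shows "\<exists>k\<in>S. card {j \<in> S. N k j \<noteq> 0} \<le> 1"
proof (rule ccontr)
  assume "\<not> ?thesis"
  then have deg: "2 \<le> card {j \<in> S. N k j \<noteq> 0}" if "k \<in> S" for k
    using that by force
  have fin: "finite S" using assms(1) finite_subset by blast
  \<comment> \<open>This scaling turns diagonal terms into 2 and the term of an edge into
    \<open>- sqrt (N i j * N j i)\<close>, which is at most -1.\<close>
  define x where "x i = (if i \<in> S then 1 / sqrt (d i) else 0)" for i
  define t where "t i j = d i * (if i = j then 2 else - real_of_int (N i j)) * x i * x j" for i j
  have t_off: "t i j \<le> - (if N i j \<noteq> 0 then 1 else 0)" if "i \<in> S" "j \<in> S" "i \<noteq> j" for i j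
  proof (cases "N i j = 0")
    case False
    have ij: "i < n" "j < n" using that assms(1) by auto
    then have "1 \<le> N i j" "1 \<le> N j i"
      using False N_zero_iff[OF ij] N_nonneg[of i j] N_nonneg[of j i] by auto
    then have "1 \<le> real_of_int (N i j * N j i)"
      using mult_mono[of 1 "N i j" 1 "N j i"] by linarith
    then have "d i * d j \<le> d i * d j * real_of_int (N i j * N j i)"
      using d_pos[OF ij(1)] d_pos[OF ij(2)] by simp
    also have "\<dots> = (d i * N i j) * (d j * N j i)" by simp
    also have "\<dots> = (d i * N i j)\<^sup>2"
      using N_symm[OF ij] by (simp add: power2_eq_square)
    finally have "sqrt (d i * d j) \<le> d i * N i j"
      using d_pos[OF ij(1)] N_nonneg[of i j] by (intro real_le_lsqrt) auto
    then show ?thesis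
      using that d_pos[OF ij(1)] d_pos[OF ij(2)] False
      by (simp add: t_def x_def real_sqrt_mult field_simps)
  qed (use that in \<open>simp add: t_def\<close>)
  have t_diag: "t i i = 2" if "i \<in> S" for i
    using that d_pos[of i] assms(1) by (auto simp: t_def x_def)
  obtain k where k: "k \<in> S" using assms(2) by auto
  have "0 < (\<Sum>i<n. \<Sum>j<n. t i j)"
    unfolding t_def using k assms(1) d_pos[of k] by (intro pos_def[of k]) (auto simp: x_def)
  also have "\<dots> = (\<Sum>i\<in>S. \<Sum>j<n. t i j)"
    by (rule sum.mono_neutral_right) (use assms(1) in \<open>auto simp: t_def x_def\<close>)
  also have "\<dots> = (\<Sum>i\<in>S. \<Sum>j\<in>S. t i j)"
    by (intro sum.cong refl sum.mono_neutral_right) (use assms(1) in \<open>auto simp: t_def x_def\<close>)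
  also have "\<dots> \<le> (\<Sum>i\<in>S. 0)"
  proof (rule sum_mono)
    fix i assume i: "i \<in> S"
    have iN: "N i i = 0" using i assms(1) N_diag by auto
    have "(\<Sum>j\<in>S. t i j) = 2 + (\<Sum>j\<in>S - {i}. t i j)"
      using i fin by (simp add: sum.remove t_diag)
    also have "\<dots> \<le> 2 + (\<Sum>j\<in>S - {i}. - (if N i j \<noteq> 0 then 1 else 0))"
      using i t_off by (intro add_left_mono sum_mono) auto
    also have "(\<Sum>j\<in>S - {i}. - (if N i j \<noteq> 0 then 1 else 0 :: real)) =
        - real (card {j \<in> S. N i j \<noteq> 0})"
    proof -
      have "(\<Sum>j\<in>S - {i}. (if N i j \<noteq> 0 then 1 else 0 :: real)) =
          (\<Sum>j\<in>S. (if N i j \<noteq> 0 then 1 else 0 :: real))"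
        using i fin iN by (simp add: sum.remove)
      also have "\<dots> = real (card {j \<in> S. N i j \<noteq> 0})"
        using fin by (simp add: sum.If_cases Int_def)
      finally show ?thesis by (simp add: sum_negf)
    qed
    also have "2 + - real (card {j \<in> S. N i j \<noteq> 0}) \<le> 0" using deg[OF i] by simp
    finally show "(\<Sum>j\<in>S. t i j) \<le> 0" by simp
  qed
  finally show False by simp
qed

text \<open>Such a function exists because the diagram is a forest: a vertex with at most one
  neighbour, supplied by \<open>exists_leaf\<close>, gets its height after all others.\<close>

lemma exists_height:
  fixes b :: "nat \<Rightarrow> nat \<Rightarrow> int"
  assumes b_abs: "\<And>i j. i < n \<Longrightarrow> j < n \<Longrightarrow> \<bar>b i j\<bar> = N i j"
    and b_sgn: "\<And>i j. i < n \<Longrightarrow> j < n \<Longrightarrow> sgn (b j i) = - sgn (b i j)"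
  shows "\<exists>\<theta> :: nat \<Rightarrow> int. \<forall>i<n. \<forall>j<n. b i j \<noteq> 0 \<longrightarrow> \<theta> i - \<theta> j = sgn (b i j)"
proof -
  have "\<exists>\<theta> :: nat \<Rightarrow> int. \<forall>i\<in>S. \<forall>j\<in>S. b i j \<noteq> 0 \<longrightarrow> \<theta> i - \<theta> j = sgn (b i j)"
    if "S \<subseteq> {..<n}" for S
    using finite_subset[OF that finite_lessThan] that
  proof (induction "card S" arbitrary: S)
    case 0
    then show ?case by auto
  next
    case (Suc c)
    then have "S \<noteq> {}" by auto
    then obtain k where k: "k \<in> S" "card {j \<in> S. N k j \<noteq> 0} \<le> 1"
      using exists_leaf Suc.prems by blast
    have "card (S - {k}) = c" using Suc.hyps(2) Suc.prems k by simp
    then obtain \<theta> :: "nat \<Rightarrow> int" where \<theta>: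
      "\<forall>i\<in>S - {k}. \<forall>j\<in>S - {k}. b i j \<noteq> 0 \<longrightarrow> \<theta> i - \<theta> j = sgn (b i j)"
      using Suc.hyps(1)[of "S - {k}"] Suc.prems by auto
    have kn: "k < n" using k Suc.prems by auto
    have bk: "b k j \<noteq> 0 \<longleftrightarrow> N k j \<noteq> 0" if "j \<in> S" for j
      using b_abs[of k j] kn that Suc.prems by auto
    have bkk: "b k k = 0" using b_abs[of k k] N_diag[of k] kn by simp
    have sym: "b j k = 0 \<longleftrightarrow> b k j = 0" if "j \<in> S" for j
      using b_sgn[of k j] kn that Suc.prems by (auto simp: sgn_if split: if_splits)
    obtain l where l: "{j \<in> S. N k j \<noteq> 0} \<subseteq> {l}"
    proof -
      have "\<forall>i\<in>{j \<in> S. N k j \<noteq> 0}. \<forall>j\<in>{j \<in> S. N k j \<noteq> 0}. i = j"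
        using k(2) Suc.prems(1) by (subst (asm) One_nat_def, subst (asm) card_le_Suc0_iff_eq) auto
      then show ?thesis using that by blast
    qed
    \<comment> \<open>\<open>l\<close> is the only possible neighbour of \<open>k\<close>. If
      \<open>k\<close> has none, its height is unconstrained.\<close>
    let ?\<theta> = "\<theta>(k := \<theta> l + sgn (b k l))"
    have "?\<theta> i - ?\<theta> j = sgn (b i j)" if ij: "i \<in> S" "j \<in> S" "b i j \<noteq> 0" for i j
    proof -
      consider "i = k" "j = k" | "i = k" "j \<noteq> k" | "i \<noteq> k" "j = k" | "i \<noteq> k" "j \<noteq> k" by blast
      then show ?thesis
      proof cases
        case 1 then show ?thesis using bkk ij by simp
      next
        case 2 then show ?thesis using bk[of j] l ij by auto
      next
        case 3
        then have "i = l" using bk[of i] sym[of i] l ij by auto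
        then show ?thesis using 3 b_sgn[of k i] kn ij Suc.prems by auto
      next
        case 4 then show ?thesis using \<theta> ij by auto
      qed
    qed
    then show ?case by blast
  qed
  from this[of "{..<n}"] show ?thesis by auto
qed

text \<open>
  The weights are \<open>p = A\<^sup>-\<^sup>T 1\<close> for the Cartan matrix \<open>A\<close>; they are positive because \<open>A\<close> is a
  nonsingular M-matrix.
\<close>

lemma exists_weights:
  "\<exists>(p :: nat \<Rightarrow> real) \<epsilon>. 0 < \<epsilon> \<and> (\<forall>j<n. 0 < p j) \<and>
     (\<forall>j<n. (\<Sum>k<n. p k * N k j) \<le> (2 - \<epsilon>) * p j)"
proof -
  \<comment> \<open>\<open>A\<close> is the symmetrized matrix: the Cartan matrix with row
    \<open>i\<close> scaled by \<open>d i\<close>. Solving \<open>A q = 1\<close> and scaling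
    \<open>q\<close> by \<open>d\<close> gives the weights \<open>p\<close>.\<close>
  define A :: "nat \<Rightarrow> nat \<Rightarrow> real"
    where "A i j = d i * (if i = j then 2 else - real_of_int (N i j))" for i j
  have A_symm: "A i j = A j i" if "i < n" "j < n" for i j
    using N_symm[OF that] by (auto simp: A_def)
  have A_pos: "0 < (\<Sum>i<n. \<Sum>j<n. A i j * x i * x j)" if "i < n" "x i \<noteq> 0" for x i
    using pos_def[OF that(1), of x] that(2) by (simp add: A_def)
  define S where "S = mat n n (\<lambda>(i, j). A i j)"
  have S: "S \<in> carrier_mat n n" by (simp add: S_def)
  have "det S \<noteq> 0"
  proof
    assume "det S = 0"
    then obtain v where v: "v \<in> carrier_vec n" "v \<noteq> 0\<^sub>v n" "S *\<^sub>v v = 0\<^sub>v n"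
      using det_0_iff_vec_prod_zero_field[OF S] by auto
    have Sv: "(\<Sum>j<n. A i j * v $ j) = 0" if "i < n" for i
    proof -
      have "(S *\<^sub>v v) $ i = 0" using v(3) that by simp
      then show ?thesis
        using that v(1) by (simp add: S_def scalar_prod_def atLeast0LessThan)
    qed
    have "(\<Sum>i<n. \<Sum>j<n. A i j * v $ i * v $ j) = (\<Sum>i<n. v $ i * (\<Sum>j<n. A i j * v $ j))"
      by (simp add: sum_distrib_left algebra_simps)
    also have "\<dots> = 0" using Sv by simp
    finally have "(\<Sum>i<n. \<Sum>j<n. A i j * v $ i * v $ j) = 0" .
    moreover obtain i where "i < n" "v $ i \<noteq> 0"
      using v(1,2) by (metis carrier_vecD eq_vecI index_zero_vec)
    ultimately show False using A_pos[of i "\<lambda>i. v $ i"] by simp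
  qed
  then obtain T where T: "T \<in> carrier_mat n n" "S * T = 1\<^sub>m n"
    using det_non_zero_imp_unit[OF S, of "()"] by (auto simp: Units_def ring_mat_def)
  define q where "q i = (T *\<^sub>v vec n (\<lambda>_. 1)) $ i" for i
  have q: "(\<Sum>j<n. A i j * q j) = 1" if "i < n" for i
  proof -
    have "S *\<^sub>v (T *\<^sub>v vec n (\<lambda>_. 1)) = vec n (\<lambda>_. 1)"
      using S T by (simp flip: assoc_mult_mat_vec[OF S T(1)])
    then have "(S *\<^sub>v (T *\<^sub>v vec n (\<lambda>_. 1))) $ i = 1" using that by simp
    moreover have "dim_vec (T *\<^sub>v vec n (\<lambda>_. 1)) = n" using T(1) by simp
    ultimately show ?thesis
      using that unfolding q_def by (simp add: S_def scalar_prod_def atLeast0LessThan)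
  qed
  have q_nonneg: "0 \<le> q i" if i: "i < n" for i
  proof (rule ccontr)
    assume "\<not> 0 \<le> q i"
    \<comment> \<open>\<open>r\<close> is the negative part of \<open>q\<close>. Since off-diagonal
      entries of \<open>A\<close> are nonpositive, the form at \<open>r\<close> is at most minus the
      pairing of \<open>r\<close> with \<open>A q = 1\<close>, hence nonpositive although
      \<open>r\<close> is not zero.\<close>
    define r where "r i = max (- q i) 0" for i
    have "A i j * r i * r j \<le> - r i * (A i j * q j)" if "i < n" "j < n" for i j
    proof (cases "i = j")
      case True then show ?thesis by (auto simp: r_def max_def)
    next
      case False
      have "A i j * r i \<le> 0"
        using False d_pos[of i] that N_nonneg[of i j]
        by (auto simp: A_def r_def intro!: mult_nonpos_nonneg mult_nonneg_nonneg)
      then have "A i j * r i * r j \<le> A i j * r i * (- q j)"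
        by (intro mult_left_mono_neg) (auto simp: r_def)
      then show ?thesis by (simp add: algebra_simps)
    qed
    then have "(\<Sum>i<n. \<Sum>j<n. A i j * r i * r j) \<le> (\<Sum>i<n. \<Sum>j<n. - r i * (A i j * q j))"
      by (intro sum_mono) auto
    also have "\<dots> = (\<Sum>i<n. - r i * (\<Sum>j<n. A i j * q j))"
      by (simp add: sum_distrib_left)
    also have "\<dots> = (\<Sum>i<n. - r i)" using q by simp
    also have "\<dots> \<le> 0" by (intro sum_nonpos) (auto simp: r_def)
    finally show False
      using A_pos[of i r] i \<open>\<not> 0 \<le> q i\<close> by (auto simp: r_def)
  qed
  define p where "p j = d j * q j" for j
  have p_nonneg: "0 \<le> p j" if "j < n" for j
    using q_nonneg[OF that] d_pos[OF that] by (simp add: p_def)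
  have p_eq: "(\<Sum>k<n. p k * N k j) = 2 * p j - 1" if j: "j < n" for j
  proof -
    have "1 = (\<Sum>k<n. A k j * q k)"
      using q[OF j] A_symm[OF j] by (simp cong: sum.cong_simp)
    also have "\<dots> = (\<Sum>k<n. (if k = j then 2 * p j else 0) - p k * N k j)"
      using N_diag[OF j] by (intro sum.cong) (auto simp: A_def p_def)
    also have "\<dots> = 2 * p j - (\<Sum>k<n. p k * N k j)"
      using j by (simp add: sum_subtractf)
    finally show ?thesis by simp
  qed
  \<comment> \<open>Strictness comes from the 1 in \<open>p_eq\<close>: \<open>2 * p j\<close> is 1
    plus a nonnegative sum.\<close>
  have p_pos: "0 < p j" if j: "j < n" for j
  proof -
    have "0 \<le> (\<Sum>k<n. p k * N k j)" using p_nonneg N_nonneg by (intro sum_nonneg) auto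
    then show ?thesis using p_eq[OF j] by simp
  qed
  \<comment> \<open>An upper bound for all \<open>p j\<close>; the added 1 keeps it positive for
    \<open>n = 0\<close> too. With \<open>\<epsilon> = 1 / P\<close>, the product
    \<open>\<epsilon> * p j\<close> is at most the 1 that \<open>p_eq\<close> leaves to
    spare.\<close>
  define P where "P = 1 + (\<Sum>k<n. p k)"
  have P: "0 < P" "p j \<le> P" if "j < n" for j
  proof -
    have "p j \<le> (\<Sum>k<n. p k)" using that p_nonneg by (intro member_le_sum) auto
    then show "0 < P" "p j \<le> P" using p_nonneg[OF that] by (auto simp: P_def)
  qed
  have P_pos: "0 < P" using p_nonneg by (auto simp: P_def intro!: add_pos_nonneg sum_nonneg)
  have "(\<Sum>k<n. p k * N k j) \<le> (2 - 1 / P) * p j" if "j < n" for j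
  proof -
    have "p j / P \<le> 1" using P[OF that] by simp
    then show ?thesis using p_eq[OF that] by (simp add: algebra_simps)
  qed
  with P_pos p_pos show ?thesis by (intro exI[of _ p] exI[of _ "1 / P"]) auto
qed

end

section \<open>Nonnegative strictly concave sequences\<close>

text \<open>The increments \<open>e\<close> never increase, and a negative one would drive
  \<open>g\<close> below zero, so \<open>g\<close> is nondecreasing. A positive value of
  \<open>g\<close> would then lower the increments by at least a fixed amount at each later step,
  until one is negative.\<close>

lemma nonneg_concave_zero:
  fixes g :: "nat \<Rightarrow> real"
  assumes "0 < \<epsilon>" and nonneg: "\<And>s. 0 \<le> g s"
    and rec: "\<And>s. g (s + 2) + g s \<le> (2 - \<epsilon>) * g (s + 1)"
  shows "g s = 0"
proof -
  define e where "e s = g (Suc s) - g s" for s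
  have e_Suc: "e (Suc s) \<le> e s - \<epsilon> * g (Suc s)" for s
    using rec[of s] by (simp add: e_def algebra_simps)
  have e_dec: "e (s + t) \<le> e s" for s t
  proof (induction t)
    case (Suc t)
    then show ?case using e_Suc[of "s + t"] nonneg[of "Suc (s + t)"] assms(1)
      by (smt (verit) add_Suc_right mult_nonneg_nonneg)
  qed simp
  have g_le: "g (s + t) \<le> g s + real t * e s" for s t
  proof (induction t)
    case (Suc t)
    then show ?case using e_dec[of s t] by (simp add: e_def algebra_simps)
  qed simp
  have e_nonneg: "0 \<le> e s" for s
  proof (rule ccontr)
    assume "\<not> 0 \<le> e s"
    then obtain t where "g s < real t * - e s"
      using reals_Archimedean3[of "- e s"] by auto
    then show False using g_le[of s t] nonneg[of "s + t"] by simp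
  qed
  have g_mono: "g s \<le> g (s + t)" for s t
  proof (induction t)
    case (Suc t)
    then show ?case using e_nonneg[of "s + t"] by (simp add: e_def)
  qed simp
  have e_le: "e (s + t) \<le> e s - real t * (\<epsilon> * g s)" for s t
  proof (induction t)
    case (Suc t)
    have "\<epsilon> * g s \<le> \<epsilon> * g (Suc (s + t))"
      using g_mono[of s "Suc t"] assms(1) by simp
    then show ?case using e_Suc[of "s + t"] Suc by (simp add: algebra_simps)
  qed simp
  show ?thesis
  proof (rule ccontr)
    assume "g s \<noteq> 0"
    then have "0 < \<epsilon> * g s" using nonneg[of s] assms(1) by simp
    then obtain t where "e s < real t * (\<epsilon> * g s)"
      using reals_Archimedean3 by blast
    then show False using e_le[of s t] e_nonneg[of "s + t"] by simp
  qed
qed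

subsection \<open>The bipartite belt\<close>

text \<open>For nonnegative \<open>N\<close>, the class \<open>C\<close> has nonnegative columns and
  nonpositive rows in the top part: it consists of sources and is the class to be mutated
  next.\<close>

definition bipartite_form :: "nat \<Rightarrow> (nat \<Rightarrow> nat \<Rightarrow> int) \<Rightarrow> nat set \<Rightarrow> int mat \<Rightarrow> bool" where
  "bipartite_form n N C B \<longleftrightarrow> (\<forall>i<n. \<forall>j<n. B $$ (i, j) =
     (if i \<in> C \<and> j \<notin> C then - N i j else if i \<notin> C \<and> j \<in> C then N i j else 0))"

text \<open>Mutating all of \<open>C\<close> reverses every edge, since each edge has exactly one
  end in \<open>C\<close>. The complement becomes the class of sources.\<close>

lemma bipartite_form_step:
  assumes bip: "bipartite_form n N C B" and "\<And>i j. 0 \<le> N i j" and C: "C \<subseteq> {..<n}"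
    and dim: "dim_col B = n" "n \<le> dim_row B"
  shows "bipartite_form n N ({..<n} - C) (mutate_seq (sorted_list_of_set C) B)"
    and "k \<in> C \<Longrightarrow> mutation_map_seq B (sorted_list_of_set C) x $ k = - x $ k"
    and "k < n \<Longrightarrow> k \<notin> C \<Longrightarrow> mutation_map_seq B (sorted_list_of_set C) x $ k =
           x $ k + (\<Sum>j\<in>C. real_of_int (N k j) * max (x $ j) 0)"
proof -
  let ?ks = "sorted_list_of_set C"
  have ks: "distinct ?ks" "set ?ks = C" "set ?ks \<subseteq> {..<n}"
    using C finite_subset[OF C] by auto
  have B: "B $$ (i, j) =
     (if i \<in> C \<and> j \<notin> C then - N i j else if i \<notin> C \<and> j \<in> C then N i j else 0)"
    if "i < n" "j < n" for i j
    using bip that by (simp add: bipartite_form_def)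
  have src: "\<forall>k\<in>set ?ks. \<forall>i<n. 0 \<le> B $$ (i, k) \<and> B $$ (k, i) \<le> 0"
    using ks(2) C B assms(2) by auto
  have indep: "\<forall>k\<in>set ?ks. \<forall>l\<in>set ?ks. B $$ (k, l) = 0"
  proof (intro ballI)
    fix k l assume "k \<in> set ?ks" "l \<in> set ?ks"
    then show "B $$ (k, l) = 0" using ks(2) C B[of k l] by auto
  qed
  note * = mutate_sources[OF dim ks(1,3) src indep]
  show "bipartite_form n N ({..<n} - C) (mutate_seq ?ks B)"
    unfolding bipartite_form_def
  proof (intro allI impI)
    fix i j assume ij: "i < n" "j < n"
    show "mutate_seq ?ks B $$ (i, j) =
        (if i \<in> {..<n} - C \<and> j \<notin> {..<n} - C then - N i j
         else if i \<notin> {..<n} - C \<and> j \<in> {..<n} - C then N i j else 0)"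
      using *(1)[OF ij] ks(2) B[OF ij] ij by auto
  qed
  show "k \<in> C \<Longrightarrow> mutation_map_seq B ?ks x $ k = - x $ k"
    using *(2)[of k x] ks(2) C by auto
  show "mutation_map_seq B ?ks x $ k = x $ k + (\<Sum>j\<in>C. real_of_int (N k j) * max (x $ j) 0)"
    if k: "k < n" "k \<notin> C"
  proof -
    have "(\<Sum>j\<in>C. real_of_int (B $$ (k, j)) * max (x $ j) 0) =
        (\<Sum>j\<in>C. real_of_int (N k j) * max (x $ j) 0)"
      using k C B by (intro sum.cong) auto
    then show ?thesis using *(2)[of k x] ks(2) k by simp
  qed
qed

definition belt_class :: "nat \<Rightarrow> nat set \<Rightarrow> nat \<Rightarrow> nat set" where
  "belt_class n C s = (if even s then C else {..<n} - C)"

text \<open>Later mutations stand in front, because the last entry of a sequence acts first.\<close>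

primrec belt :: "nat \<Rightarrow> nat set \<Rightarrow> nat \<Rightarrow> nat list" where
  "belt n C 0 = []"
| "belt n C (Suc s) = sorted_list_of_set (belt_class n C s) @ belt n C s"

context positive_cartan
begin

lemma dominance_region_bipartite_top:
  assumes bip: "bipartite_form n N C B" and C: "C \<subseteq> {..<n}"
    and dim: "dim_col B = n" "n \<le> dim_row B" and lam: "lam \<in> carrier_vec (dim_row B)"
    and x: "x \<in> dominance_region B lam" and "k < n"
  shows "x $ k = lam $ k"
proof -
  define D where "D s = belt_class n C s" for s
  define M where "M s = mutate_seq (belt n C s) B" for s
  define X where "X s = mutation_map_seq B (belt n C s) x" for s
  define L where "L s = mutation_map_seq B (belt n C s) lam" for s
  have D: "D s \<subseteq> {..<n}" "finite (D s)" for s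
    using C finite_subset[OF C] by (auto simp: D_def belt_class_def)
  have D_Suc: "D (Suc s) = {..<n} - D s" "D (s + 2) = D s" for s
    using C by (auto simp: D_def belt_class_def)
  have M_Suc: "M (Suc s) = mutate_seq (sorted_list_of_set (D s)) (M s)"
    and X_Suc: "X (Suc s) = mutation_map_seq (M s) (sorted_list_of_set (D s)) (X s)"
    and L_Suc: "L (Suc s) = mutation_map_seq (M s) (sorted_list_of_set (D s)) (L s)" for s
    by (simp_all add: M_def X_def L_def D_def mutate_seq_append mutation_map_seq_append)
  have dimM: "dim_col (M s) = n" "dim_row (M s) = dim_row B" for s
    using dim by (simp_all add: M_def)
  have bipM: "bipartite_form n N (D s) (M s)" for s
  proof (induction s)
    case 0
    then show ?case using bip by (simp add: D_def M_def belt_class_def)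
  next
    case (Suc s)
    from bipartite_form_step(1)[OF Suc N_nonneg D(1)] show ?case
      using dimM dim by (simp add: M_Suc D_Suc)
  qed
  note step = bipartite_form_step(2,3)[OF bipM N_nonneg D(1) dimM(1)]
  have flip: "X (Suc s) $ k = - X s $ k" "L (Suc s) $ k = - L s $ k" if "k \<in> D s" for s k
    using step(1)[OF _ that] dimM dim by (simp_all add: X_Suc L_Suc)
  have grow: "X (Suc s) $ k = X s $ k + (\<Sum>j\<in>D s. real_of_int (N k j) * max (X s $ j) 0)"
    "L (Suc s) $ k = L s $ k + (\<Sum>j\<in>D s. real_of_int (N k j) * max (L s $ j) 0)"
    if "k < n" "k \<notin> D s" for s k
    using step(2)[OF _ that] dimM dim by (simp_all add: X_Suc L_Suc)
  have belt: "set (belt n C s) \<subseteq> {..<n}" for s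
    using D by (induction s) (auto simp: D_def)
  define w where "w s k = L s $ k - X s $ k" for s k
  \<comment> \<open>Rows of the source class are nonpositive, so adding a nonnegative combination of
    columns to \<open>L s\<close> cannot raise its coordinates there.\<close>
  have w_nonneg: "0 \<le> w s k" if k: "k \<in> D s" for s k
  proof -
    have "X s \<in> dominance_region (M s) (L s)"
      unfolding X_def M_def L_def
      by (rule dominance_region_mutate[OF x]) (use belt dim in auto)
    moreover have "L s \<in> carrier_vec (dim_row (M s))"
      unfolding L_def dimM using mutation_map_seq_carrier[OF lam] .
    ultimately obtain \<alpha> where \<alpha>: "\<And>j. j < n \<Longrightarrow> 0 \<le> \<alpha> j"
      "\<And>i. i < dim_row B \<Longrightarrow> X s $ i = L s $ i + (\<Sum>j<n. real_of_int (M s $$ (i, j)) * \<alpha> j)"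
      by (rule dominance_regionE) (use dimM in auto)
    have "(\<Sum>j<n. real_of_int (M s $$ (k, j)) * \<alpha> j) \<le> 0"
      using bipM[of s] k D(1)[of s] \<alpha>(1) N_nonneg
      by (intro sum_nonpos) (auto simp: bipartite_form_def)
    then show ?thesis using \<alpha>(2)[of k] k D(1)[of s] dim by (auto simp: w_def)
  qed
  \<comment> \<open>Step \<open>s\<close> negates coordinate \<open>k\<close> and the next step adds
    contributions from the other class, so \<open>w (s + 2) k\<close> is \<open>- w s k\<close> plus
    a sum over that class.\<close>
  have w_rec: "w (s + 2) k + w s k \<le> (\<Sum>j\<in>D (s + 1). real_of_int (N k j) * w (s + 1) j)"
    if k: "k \<in> D s" for s k
  proof -
    have k': "k < n" "k \<notin> D (Suc s)" using k D(1) by (auto simp: D_Suc)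
    have "w (s + 2) k + w s k =
        (\<Sum>j\<in>D (Suc s). real_of_int (N k j) * (max (L (Suc s) $ j) 0 - max (X (Suc s) $ j) 0))"
      using grow[OF k'] flip[OF k]
      by (simp add: w_def sum_subtractf right_diff_distrib)
    also have "\<dots> \<le> (\<Sum>j\<in>D (Suc s). real_of_int (N k j) * w (Suc s) j)"
    proof (intro sum_mono mult_left_mono)
      \<comment> \<open>Where \<open>L\<close> is at least \<open>X\<close>, passing to positive
        parts cannot increase their difference.\<close>
      fix j assume "j \<in> D (Suc s)"
      from w_nonneg[OF this]
      show "max (L (Suc s) $ j) 0 - max (X (Suc s) $ j) 0 \<le> w (Suc s) j"
        by (auto simp: w_def)
    qed (use N_nonneg in auto)
    finally show ?thesis by simp
  qed
  obtain p :: "nat \<Rightarrow> real" and \<epsilon> where p: "0 < \<epsilon>" "\<And>j. j < n \<Longrightarrow> 0 < p j"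
    "\<And>j. j < n \<Longrightarrow> (\<Sum>k<n. p k * N k j) \<le> (2 - \<epsilon>) * p j"
    using exists_weights by blast
  have p_nonneg: "0 \<le> p k" if "k \<in> D s" for k s
    using p(2)[of k] D(1)[of s] that by auto
  define g where "g s = (\<Sum>k\<in>D s. p k * w s k)" for s
  have g_nonneg: "0 \<le> g s" for s
    unfolding g_def using w_nonneg p_nonneg by (intro sum_nonneg mult_nonneg_nonneg) auto
  have g_rec: "g (s + 2) + g s \<le> (2 - \<epsilon>) * g (s + 1)" for s
  proof -
    have "g (s + 2) + g s = (\<Sum>k\<in>D s. p k * (w (s + 2) k + w s k))"
      unfolding g_def D_Suc(2) by (simp add: sum.distrib distrib_left)
    also have "\<dots> \<le> (\<Sum>k\<in>D s. p k * (\<Sum>j\<in>D (s + 1). real_of_int (N k j) * w (s + 1) j))"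
      using w_rec p_nonneg by (intro sum_mono mult_left_mono) auto
    also have "\<dots> = (\<Sum>j\<in>D (s + 1). (\<Sum>k\<in>D s. p k * N k j) * w (s + 1) j)"
      by (simp add: sum_distrib_left sum_distrib_right mult.assoc)
         (rule sum.swap)
    also have "\<dots> \<le> (\<Sum>j\<in>D (s + 1). (2 - \<epsilon>) * p j * w (s + 1) j)"
    proof (intro sum_mono mult_right_mono)
      fix j assume j: "j \<in> D (s + 1)"
      \<comment> \<open>Extending the sum to all \<open>k < n\<close> adds nonnegative terms and
        brings it into the form of the weight inequality.\<close>
      have "(\<Sum>k\<in>D s. p k * N k j) \<le> (\<Sum>k<n. p k * N k j)"
        using D N_nonneg by (intro sum_mono2) (auto simp: p(2) less_imp_le)
      also have "\<dots> \<le> (2 - \<epsilon>) * p j" using p(3) j D(1) by auto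
      finally show "(\<Sum>k\<in>D s. p k * N k j) \<le> (2 - \<epsilon>) * p j" .
    qed (use w_nonneg in auto)
    also have "\<dots> = (2 - \<epsilon>) * g (s + 1)"
      by (simp add: g_def sum_distrib_left mult.assoc)
    finally show ?thesis .
  qed
  have w0: "w s k = 0" if k: "k \<in> D s" for s k
  proof -
    have "(\<Sum>k\<in>D s. p k * w s k) = 0"
      using nonneg_concave_zero[of \<epsilon> g, OF p(1) g_nonneg g_rec] by (simp add: g_def)
    moreover have "0 \<le> p k * w s k" if "k \<in> D s" for k
      using that w_nonneg p_nonneg by (intro mult_nonneg_nonneg) auto
    ultimately have "p k * w s k = 0"
      using k D(2) by (simp add: sum_nonneg_eq_0_iff)
    then show ?thesis using p(2)[of k] k D(1)[of s] by auto
  qed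
  have X0: "X 0 = x" "L 0 = lam" by (simp_all add: X_def L_def)
  show ?thesis
  proof (cases "k \<in> D 0")
    case True
    then show ?thesis using w0[of k 0] X0 by (simp add: w_def)
  next
    case False
    \<comment> \<open>Outside \<open>D 0\<close> the comparison is made one step later:
      \<open>k\<close> lies in \<open>D 1\<close>, and the corrections of the first step agree for
      \<open>x\<close> and \<open>lam\<close>.\<close>
    have "max (X 0 $ j) 0 = max (L 0 $ j) 0" if "j \<in> D 0" for j
      using w0[OF that] by (simp add: w_def)
    then have "(\<Sum>j\<in>D 0. real_of_int (N k j) * max (X 0 $ j) 0) =
        (\<Sum>j\<in>D 0. real_of_int (N k j) * max (L 0 $ j) 0)"
      by (intro sum.cong) auto
    moreover have "w 1 k = 0" using False \<open>k < n\<close> by (intro w0) (simp add: D_Suc)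
    ultimately show ?thesis
      using grow[OF \<open>k < n\<close> False] X0 by (simp add: w_def)
  qed
qed

text \<open>
  With equal top parts, \<open>x - lam\<close> is a nonnegative combination of the columns of \<open>B\<close> at isolated
  vertices, and mutation at isolated vertices negates any chosen subset of these columns. A
  suitable choice makes row \<open>i\<close> of them nonnegative, the complementary choice nonpositive.
\<close>

lemma dominance_region_bipartite:
  assumes bip: "bipartite_form n N C B" and C: "C \<subseteq> {..<n}"
    and dim: "dim_col B = n" "n \<le> dim_row B" and lam: "lam \<in> carrier_vec (dim_row B)"
    and x: "x \<in> dominance_region B lam"
  shows "x = lam"
proof -
  have top: "x $ k = lam $ k" if "k < n" for k
    using dominance_region_bipartite_top[OF assms that] .
  \<comment> \<open>These vertices are isolated, though their columns may have nonzero entries in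
    the rows from \<open>n\<close> on.\<close>
  define I where "I = {j. j < n \<and> (\<forall>i<n. B $$ (i, j) = 0)}"
  \<comment> \<open>The coefficients may depend on \<open>J\<close>, but the difference they
    represent does not, so different sign choices constrain the same number.\<close>
  have combination: "\<exists>\<alpha>. (\<forall>j\<in>I. 0 \<le> \<alpha> j) \<and> (\<forall>i<dim_row B. x $ i - lam $ i =
      (\<Sum>j\<in>I. real_of_int (if j \<in> J then - B $$ (i, j) else B $$ (i, j)) * \<alpha> j))"
    if J: "J \<subseteq> I" for J
  proof -
    let ?ks = "sorted_list_of_set J"
    have "finite J" using J finite_subset[of J "{..<n}"] by (auto simp: I_def)
    then have ks: "distinct ?ks" "set ?ks = J" "set ?ks \<subseteq> {..<n}"
      using J by (auto simp: I_def)
    have "\<forall>k\<in>set ?ks. \<forall>j<n. B $$ (k, j) = 0"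
    proof (intro ballI allI impI)
      fix k j assume that: "k \<in> set ?ks" "j < n"
      have "k < n" "B $$ (j, k) = 0" using that ks(2) J by (auto simp: I_def)
      then show "B $$ (k, j) = 0"
        using bip that N_zero_iff[of j k] by (auto simp: bipartite_form_def split: if_splits)
    qed
    note M = mutate_isolated[OF dim ks(1,3) this, unfolded ks(2)]
    have M_top: "mutate_seq ?ks B $$ (i, j) = B $$ (i, j)" if "i < n" "j < n" for i j
      using that M[of i j] dim J by (auto simp: I_def)
    have "mutation_map_seq B ?ks x \<in>
        dominance_region (mutate_seq ?ks B) (mutation_map_seq B ?ks lam)"
      by (rule dominance_region_mutate[OF x]) (use ks(3) dim in simp)
    moreover have "mutation_map_seq B ?ks lam \<in> carrier_vec (dim_row (mutate_seq ?ks B))"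
      using mutation_map_seq_carrier[OF lam] unfolding dim_mutate_seq .
    ultimately obtain \<alpha> where \<alpha>: "\<And>j. j < n \<Longrightarrow> 0 \<le> \<alpha> j"
      "\<And>i. i < dim_row B \<Longrightarrow> mutation_map_seq B ?ks x $ i = mutation_map_seq B ?ks lam $ i +
         (\<Sum>j<n. real_of_int (mutate_seq ?ks B $$ (i, j)) * \<alpha> j)"
      by (rule dominance_regionE) (use dim in auto)
    \<comment> \<open>The top coordinates agree, so the mutation maps preserve the difference of
      \<open>x\<close> and \<open>lam\<close>.\<close>
    have diff: "x $ i - lam $ i = (\<Sum>j<n. real_of_int (mutate_seq ?ks B $$ (i, j)) * \<alpha> j)"
      if "i < dim_row B" for i
      using \<alpha>(2)[OF that] mutation_map_seq_diff[OF ks(3) dim(2) _ that, of x lam] top by simp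
    \<comment> \<open>In bipartite form the nonzero entries of a row \<open>i < n\<close> share the
      sign \<open>\<sigma>\<close>. The combination vanishes in that row, so each of its terms
      does.\<close>
    have \<alpha>0: "\<alpha> j = 0" if j: "j < n" "j \<notin> I" for j
    proof -
      obtain i where i: "i < n" "B $$ (i, j) \<noteq> 0" using j by (auto simp: I_def)
      define \<sigma> :: real where "\<sigma> = (if i \<in> C then -1 else 1)"
      have nonneg: "0 \<le> \<sigma> * (real_of_int (B $$ (i, j)) * \<alpha> j)" if "j < n" for j
        using bip i(1) that \<alpha>(1)[OF that] N_nonneg[of i j]
        by (auto simp: bipartite_form_def \<sigma>_def)
      have "(\<Sum>j<n. real_of_int (B $$ (i, j)) * \<alpha> j) = 0"
        using diff[of i] i(1) dim(2) top[of i] M_top by simp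
      then have "(\<Sum>j<n. \<sigma> * (real_of_int (B $$ (i, j)) * \<alpha> j)) = 0"
        by (simp flip: sum_distrib_left)
      then have "\<sigma> * (real_of_int (B $$ (i, j)) * \<alpha> j) = 0"
        using j(1) nonneg
          sum_nonneg_eq_0_iff[of "{..<n}" "\<lambda>j. \<sigma> * (real_of_int (B $$ (i, j)) * \<alpha> j)"] by auto
      then show ?thesis using i(2) by (auto simp: \<sigma>_def split: if_splits)
    qed
    show ?thesis
    proof (intro exI[of _ \<alpha>] conjI ballI allI impI)
      fix i assume i: "i < dim_row B"
      have "x $ i - lam $ i = (\<Sum>j\<in>I. real_of_int (mutate_seq ?ks B $$ (i, j)) * \<alpha> j)"
        unfolding diff[OF i] using \<alpha>0
        by (intro sum.mono_neutral_right) (auto simp: I_def)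
      also have "\<dots> =
          (\<Sum>j\<in>I. real_of_int (if j \<in> J then - B $$ (i, j) else B $$ (i, j)) * \<alpha> j)"
        using M[OF i] by (intro sum.cong) (auto simp: I_def)
      finally show "x $ i - lam $ i = \<dots>" .
    qed (use \<alpha>(1) in \<open>auto simp: I_def\<close>)
  qed
  have "x $ i = lam $ i" if i: "i < dim_row B" for i
  proof (rule antisym)
    \<comment> \<open>Negating the positive entries makes row \<open>i\<close> nonpositive on
      \<open>I\<close>; the other inequality negates the negative entries instead.\<close>
    obtain \<alpha> where "\<forall>j\<in>I. 0 \<le> \<alpha> j" "x $ i - lam $ i = (\<Sum>j\<in>I. real_of_int
        (if j \<in> {j \<in> I. 0 < B $$ (i, j)} then - B $$ (i, j) else B $$ (i, j)) * \<alpha> j)"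
      using combination[of "{j \<in> I. 0 < B $$ (i, j)}"] i by blast
    moreover from this(1) have "(\<Sum>j\<in>I. real_of_int
        (if j \<in> {j \<in> I. 0 < B $$ (i, j)} then - B $$ (i, j) else B $$ (i, j)) * \<alpha> j) \<le> 0"
      by (intro sum_nonpos) (auto intro!: mult_nonpos_nonneg)
    ultimately show "x $ i \<le> lam $ i" by linarith
  next
    obtain \<alpha> where "\<forall>j\<in>I. 0 \<le> \<alpha> j" "x $ i - lam $ i = (\<Sum>j\<in>I. real_of_int
        (if j \<in> {j \<in> I. B $$ (i, j) < 0} then - B $$ (i, j) else B $$ (i, j)) * \<alpha> j)"
      using combination[of "{j \<in> I. B $$ (i, j) < 0}"] i by blast
    moreover from this(1) have "0 \<le> (\<Sum>j\<in>I. real_of_int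
        (if j \<in> {j \<in> I. B $$ (i, j) < 0} then - B $$ (i, j) else B $$ (i, j)) * \<alpha> j)"
      by (intro sum_nonneg) (auto intro!: mult_nonneg_nonneg)
    ultimately show "lam $ i \<le> x $ i" by linarith
  qed
  then show ?thesis
    using lam dominance_region_carrier[OF x] by (intro eq_vecI) auto
qed

section \<open>Reaching a bipartite seed\<close>

text \<open>
  \<open>\<theta>\<close> is a height function on the Dynkin forest. Vertices of minimal height are sources, and
  mutation there raises the height by 2 until only two consecutive heights are left.
\<close>

lemma exists_bipartite_form:
  fixes \<theta> :: "nat \<Rightarrow> int"
  assumes dim: "dim_col B = n" "n \<le> dim_row B"
    and height: "\<And>i j. i < n \<Longrightarrow> j < n \<Longrightarrow> B $$ (i, j) = N i j * (\<theta> i - \<theta> j)"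
    and adjacent: "\<And>i j. i < n \<Longrightarrow> j < n \<Longrightarrow> N i j \<noteq> 0 \<Longrightarrow> \<bar>\<theta> i - \<theta> j\<bar> = 1"
    and bound: "\<And>i. i < n \<Longrightarrow> \<theta> i \<le> h"
  shows "\<exists>ks C. set ks \<subseteq> {..<n} \<and> C \<subseteq> {..<n} \<and> bipartite_form n N C (mutate_seq ks B)"
  using assms
\<comment> \<open>The measure is the total distance of the heights from the ceiling
  \<open>h\<close>.\<close>
proof (induction "\<Sum>i<n. nat (h - \<theta> i)" arbitrary: B \<theta> rule: less_induct)
  case less
  note height = less.prems(3) and adjacent = less.prems(4) and bound = less.prems(5)
  show ?case
  proof (cases "\<forall>i<n. h - 1 \<le> \<theta> i")
    case True
    then have two: "\<theta> i = h - 1 \<or> \<theta> i = h" if "i < n" for i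
      using bound[OF that] that by force
    have "bipartite_form n N {k. k < n \<and> \<theta> k = h - 1} B"
      unfolding bipartite_form_def
    proof (intro allI impI)
      fix i j assume ij: "i < n" "j < n"
      show "B $$ (i, j) =
        (if i \<in> {k. k < n \<and> \<theta> k = h - 1} \<and> j \<notin> {k. k < n \<and> \<theta> k = h - 1} then - N i j
         else if i \<notin> {k. k < n \<and> \<theta> k = h - 1} \<and> j \<in> {k. k < n \<and> \<theta> k = h - 1} then N i j
         else 0)"
        using ij two[of i] two[of j] height[OF ij] by auto
    qed
    then show ?thesis by (intro exI[of _ "[]"] exI[of _ "{k. k < n \<and> \<theta> k = h - 1}"]) auto
  next
    case False
    then obtain i0 where i0: "i0 < n" "\<theta> i0 < h - 1" by auto
    then have "Min (\<theta> ` {..<n}) \<in> \<theta> ` {..<n}" by (intro Min_in) auto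
    then obtain k where k: "k < n" "\<theta> k = Min (\<theta> ` {..<n})" by auto
    have min: "\<theta> k \<le> \<theta> i" if "i < n" for i
      using that unfolding k(2) by (intro Min_le) auto
    \<comment> \<open>All neighbours of \<open>k\<close> have height \<open>\<theta> k + 1\<close>,
      so adding 2 reverses each height difference at \<open>k\<close>, just as mutation reverses the
      entries. Minimality gives \<open>\<theta> k < h - 1\<close>, so the ceiling is
      respected.\<close>
    let ?B = "mutate_seq [k] B" and ?\<theta> = "\<theta>(k := \<theta> k + 2)"
    have src: "\<forall>l\<in>set [k]. \<forall>i<n. 0 \<le> B $$ (i, l) \<and> B $$ (l, i) \<le> 0"
      using k(1) height min N_nonneg by (auto simp: mult_nonneg_nonneg mult_nonneg_nonpos)
    have indep: "\<forall>l\<in>set [k]. \<forall>l'\<in>set [k]. B $$ (l, l') = 0"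
      using k(1) height[of k k] by auto
    have B': "?B $$ (i, j) = (if i = k \<or> j = k then - B $$ (i, j) else B $$ (i, j))"
      if "i < n" "j < n" for i j
      using mutate_sources(1)[OF less.prems(1,2) _ _ src indep that] k(1) by auto
    have up: "\<theta> j = \<theta> k + 1" if "j < n" "N k j \<noteq> 0 \<or> N j k \<noteq> 0" for j
      using adjacent[of k j] adjacent[of j k] min[of j] k(1) that by auto
    have "(\<Sum>i<n. nat (h - ?\<theta> i)) < (\<Sum>i<n. nat (h - \<theta> i))"
      using k(1) min[OF i0(1)] i0(2) by (intro sum_strict_mono_ex1) auto
    moreover have "?B $$ (i, j) = N i j * (?\<theta> i - ?\<theta> j)" if "i < n" "j < n" for i j
      using B'[OF that] height[OF that] up[of i] up[of j] that N_diag[of k] k(1)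
      by (cases "N i j = 0") auto
    moreover have "\<bar>?\<theta> i - ?\<theta> j\<bar> = 1" if "i < n" "j < n" "N i j \<noteq> 0" for i j
      using adjacent[OF that] up[of i] up[of j] that N_diag[of k] k(1) by auto
    moreover have "?\<theta> i \<le> h" if "i < n" for i
      using bound[OF that] min[OF i0(1)] i0(2) by auto
    ultimately obtain ks C where "set ks \<subseteq> {..<n}" "C \<subseteq> {..<n}"
      "bipartite_form n N C (mutate_seq ks ?B)"
      using less.hyps[of ?\<theta> ?B] less.prems(1,2) by auto
    then show ?thesis
      using k(1) by (intro exI[of _ "ks @ [k]"] exI[of _ C]) (auto simp: mutate_seq_append)
  qed
qed

end

text \<open>Finite type yields a seed with positive definite Cartan companion. The signs of its
  entries are differences of a height function, from which further mutations lead to a bipartite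
  seed.\<close>

lemma finite_type_bipartite_form:
  assumes ext: "extended_exchange_matrix m n Bt" and "finite_type n (top_part Bt)"
  obtains N d ks C where "positive_cartan n N d" "set ks \<subseteq> {..<n}" "C \<subseteq> {..<n}"
    "bipartite_form n N C (mutate_seq ks Bt)"
proof -
  have dim: "dim_col Bt = n" "n \<le> dim_row Bt"
    using ext by (auto simp: extended_exchange_matrix_def)
  obtain ls where ls: "set ls \<subseteq> {..<n}"
    and ex: "exchange_matrix n (mutate_seq ls (top_part Bt))"
    and cartan: "finite_type_cartan n (cartan_companion (mutate_seq ls (top_part Bt)))"
    using assms(2) by (auto simp: finite_type_def mutation_equivalent_def in_lists_conv_set subset_eq)
  define M where "M = mutate_seq ls Bt"
  define b where "b i j = M $$ (i, j)" for i j
  have top: "mutate_seq ls (top_part Bt) = top_part M"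
    using top_part_mutate_seq[of Bt ls] dim ls by (simp add: M_def)
  have dimM: "dim_col M = n" "n \<le> dim_row M" using dim by (simp_all add: M_def)
  have top_b: "top_part M $$ (i, j) = b i j" if "i < n" "j < n" for i j
    using that dimM by (simp add: top_part_def b_def)
  obtain c :: "nat \<Rightarrow> real" where c: "\<And>i. i < n \<Longrightarrow> 0 < c i"
    "\<And>i j. i < n \<Longrightarrow> j < n \<Longrightarrow> c i * b i j = - (c j * b j i)"
    using ex top_b unfolding exchange_matrix_def top by (metis (no_types, lifting))
  have b_diag: "b i i = 0" if "i < n" for i
    using c(1)[OF that] c(2)[OF that that] by simp
  have b_sgn: "sgn (b j i) = - sgn (b i j)" if "i < n" "j < n" for i j
  proof -
    have "sgn (c i * b i j) = sgn (- (c j * b j i))" using c(2)[OF that] by simp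
    then have "sgn (real_of_int (b i j)) = - sgn (real_of_int (b j i))"
      using c(1)[OF that(1)] c(1)[OF that(2)] by (simp add: sgn_mult sgn_minus)
    then show ?thesis by (auto simp: sgn_if split: if_splits)
  qed
  define N where "N i j = \<bar>b i j\<bar>" for i j
  have comp: "cartan_companion (top_part M) $$ (i, j) = (if i = j then 2 else - N i j)"
    if "i < n" "j < n" for i j
    using that dimM top_b[OF that] by (simp add: cartan_companion_def N_def top_part_def b_def)
  obtain d :: "nat \<Rightarrow> real" where d: "\<forall>i<n. 0 < d i"
    and d_symm: "\<forall>i<n. \<forall>j<n.
      d i * real_of_int (cartan_companion (top_part M) $$ (i, j)) =
      d j * real_of_int (cartan_companion (top_part M) $$ (j, i))"
    and d_pos: "\<forall>x\<in>carrier_vec n. x \<noteq> 0\<^sub>v n \<longrightarrow> 0 < (\<Sum>i<n. \<Sum>j<n.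
      d i * real_of_int (cartan_companion (top_part M) $$ (i, j)) * x $ i * x $ j)"
    using cartan unfolding finite_type_cartan_def top by blast
  have "positive_cartan n N d"
  proof
    show "d i * N i j = d j * N j i" if "i < n" "j < n" for i j
    proof (cases "i = j")
      case False
      then show ?thesis
        using d_symm[rule_format, OF that] unfolding comp[OF that] comp[OF that(2,1)] by simp
    qed simp
    fix x :: "nat \<Rightarrow> real" and i assume "i < n" "x i \<noteq> 0"
    then have "vec n x $ i \<noteq> 0\<^sub>v n $ i" by simp
    then have "vec n x \<noteq> 0\<^sub>v n" by auto
    with d_pos have "0 < (\<Sum>i<n. \<Sum>j<n. d i *
        real_of_int (cartan_companion (top_part M) $$ (i, j)) * vec n x $ i * vec n x $ j)"
      using vec_carrier by blast
    then show "0 < (\<Sum>i<n. \<Sum>j<n. d i * (if i = j then 2 else - real_of_int (N i j)) * x i * x j)"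
      by (simp add: comp if_distrib[of real_of_int] cong: if_cong)
  qed (use d b_diag in \<open>auto simp: N_def\<close>)
  then interpret positive_cartan n N d .
  obtain \<theta> :: "nat \<Rightarrow> int" where \<theta>:
    "\<And>i j. i < n \<Longrightarrow> j < n \<Longrightarrow> b i j \<noteq> 0 \<Longrightarrow> \<theta> i - \<theta> j = sgn (b i j)"
    using exists_height[OF N_def[symmetric] b_sgn] by blast
  have "M $$ (i, j) = N i j * (\<theta> i - \<theta> j)" if "i < n" "j < n" for i j
    using \<theta>[OF that] by (cases "b i j = 0") (auto simp: N_def b_def abs_mult_sgn)
  moreover have "\<bar>\<theta> i - \<theta> j\<bar> = 1" if "i < n" "j < n" "N i j \<noteq> 0" for i j
    using \<theta>[OF that(1,2)] that(3) by (auto simp: N_def sgn_if)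
  moreover have "\<theta> i \<le> Max (\<theta> ` {..<n})" if "i < n" for i
    using that by (intro Max_ge) auto
  ultimately obtain ks C where "set ks \<subseteq> {..<n}" "C \<subseteq> {..<n}"
    "bipartite_form n N C (mutate_seq ks M)"
    using exists_bipartite_form[OF dimM, of \<theta> "Max (\<theta> ` {..<n})"] by blast
  then show ?thesis
    using that[of N d "ks @ ls" C] ls \<open>positive_cartan n N d\<close> by (simp add: M_def mutate_seq_append)
qed

theorem theorem3p1:
  fixes m n :: nat and Bt :: "int mat" and lam :: "real vec"
  assumes "extended_exchange_matrix m n Bt"
    and "finite_type n (top_part Bt)"
    and "lam \<in> carrier_vec m"
  shows "dominance_region Bt lam = {lam}"
proof -
  have dim: "dim_row Bt = m" "dim_col Bt = n" "n \<le> m"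
    using assms(1) by (auto simp: extended_exchange_matrix_def)
  then have lam: "lam \<in> carrier_vec (dim_row Bt)" using assms(3) by simp
  obtain N d ks C where "positive_cartan n N d" and ks: "set ks \<subseteq> {..<n}"
    and C: "C \<subseteq> {..<n}" "bipartite_form n N C (mutate_seq ks Bt)"
    using finite_type_bipartite_form[OF assms(1,2)] .
  interpret positive_cartan n N d by fact
  have "x = lam" if x: "x \<in> dominance_region Bt lam" for x
  proof -
    \<comment> \<open>Equality is proved at the bipartite seed and then pulled back by injectivity
      of the mutation maps.\<close>
    have "mutation_map_seq Bt ks x = mutation_map_seq Bt ks lam"
    proof (rule dominance_region_bipartite[OF C(2,1)])
      show "mutation_map_seq Bt ks lam \<in> carrier_vec (dim_row (mutate_seq ks Bt))"
        using mutation_map_seq_carrier[OF lam] unfolding dim_mutate_seq .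
    qed (use dim ks in \<open>auto intro: dominance_region_mutate[OF x]\<close>)
    then show ?thesis
      by (rule mutation_map_seq_inj[OF dominance_region_carrier[OF x] lam, rotated])
         (use ks dim in auto)
  qed
  then show ?thesis using mem_dominance_region_self[OF lam] by blast
qed

end
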